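(* Let $X$ be a reflexive real Banach space such that $X$ and $X^*$ are strictly convex, let $A\subset X$ be nonempty, and let $f:X\to\mathbb{R}$ be Lipschitz continuous on a neighborhood of $A$. Then there is a unique $\tilde a\in\partial f(A)$ with $$\|\tilde a\|=\min_{a\in\partial f(A)}\|a\|.$$ Moreover, if $0\notin\partial f(A)$, then there exists a unique optimal descent direction $\tilde h$ of $f$ on $A$, and it is characterized by $$\langle\tilde a,\tilde h\rangle=-\|\tilde a\|\quad\text{with}\quad\|\tilde h\|=1$$ (i.e. an element $\tilde h\in X$ is the optimal descent direction of $f$ on $A$ if and only if it satisfies these two conditions).
   Context: $X^*$ is the dual of $X$ (with dual norm) and $\langle\cdot,\cdot\rangle$ the duality pairing; a space is called strictly convex if its norm is. For $f$ Lipschitz near $x$, Clarke's generalized directional derivative is $f^0(x;h)=\limsup_{y\to x,\,t\downarrow 0}\frac{f(y+th)-f(y)}{t}$ and Clarke's generalized gradient is $\partial f(x)=\{a\in X^*\mid\langle a,h\rangle\le f^0(x;h)\ \forall h\in X\}$. For nonempty $A\subset X$, the gradient of $f$ on $A$ is $\partial f(A):=\overline{\operatorname{conv}}^*\bigcup_{y\in A}\partial f(y)$ (the weak$^*$ closure of the convex hull), and the directional derivative of $f$ on $A$ in direction $h\in X$ is $f^0(A;h):=\sup_{y\in A}f^0(y;h)$. An element $\tilde h\in X$ is an optimal (steepest) descent direction of $f$ on $A$ (with respect to $\|\cdot\|$) if $\|\tilde h\|=1$ and $f^0(A;\tilde h)=\min_{\|h\|\le1}f^0(A;h)<0$. A neighborhood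 of $A$ is a set containing an open set that contains $A$. *)

theory Defs
  imports "HOL-Analysis.Analysis"
begin

type_synonym 'a dual = "'a \<Rightarrow>\<^sub>L real"

definition reflexive_space :: "'a::real_normed_vector itself \<Rightarrow> bool" where
  "reflexive_space _ \<longleftrightarrow>
     (\<forall>\<Phi> :: 'a dual dual. \<exists>x :: 'a. \<forall>\<phi> :: 'a dual. blinfun_apply \<Phi> \<phi> = blinfun_apply \<phi> x)"

definition strictly_convex_space :: "'a::real_normed_vector itself \<Rightarrow> bool" where
  "strictly_convex_space _ \<longleftrightarrow>
     (\<forall>(x::'a) y t. norm x = 1 \<and> norm y = 1 \<and> x \<noteq> y \<and> 0 < t \<and> t < 1 \<longrightarrow>
        norm ((1 - t) *\<^sub>R x + t *\<^sub>R y) < 1)"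

text \<open>On real-valued bounded linear maps the strong operator topology is the topology of
  pointwise convergence on functionals, i.e. the weak* topology.\<close>

definition weak_star_topology :: "'a::real_normed_vector dual topology" where
  "weak_star_topology = strong_operator_topology"

definition neighborhood_of :: "'a::topological_space set \<Rightarrow> 'a set \<Rightarrow> bool" where
  "neighborhood_of N A \<longleftrightarrow> (\<exists>U. open U \<and> A \<subseteq> U \<and> U \<subseteq> N)"

text \<open>The limit superior is taken in the extended reals, so that it is meaningful without any
  hypothesis on \<open>f\<close>; it is finite when \<open>f\<close> is Lipschitz near \<open>x\<close>. The filter \<open>nhds x\<close>
  (rather than \<open>at x\<close>) does not exclude the base point \<open>y = x\<close>.\<close>

definition clarke_deriv :: "('a::real_normed_vector \<Rightarrow> real) \<Rightarrow> 'a \<Rightarrow> 'a \<Rightarrow> ereal" where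
  "clarke_deriv f x h =
     Limsup (nhds x \<times>\<^sub>F at_right 0) (\<lambda>(y, t). ereal ((f (y + t *\<^sub>R h) - f y) / t))"

definition clarke_gradient :: "('a::real_normed_vector \<Rightarrow> real) \<Rightarrow> 'a \<Rightarrow> 'a dual set" where
  "clarke_gradient f x = {a. \<forall>h. ereal (blinfun_apply a h) \<le> clarke_deriv f x h}"

definition gradient_on :: "('a::real_normed_vector \<Rightarrow> real) \<Rightarrow> 'a set \<Rightarrow> 'a dual set" where
  "gradient_on f A = weak_star_topology closure_of (convex hull (\<Union>y\<in>A. clarke_gradient f y))"

definition deriv_on :: "('a::real_normed_vector \<Rightarrow> real) \<Rightarrow> 'a set \<Rightarrow> 'a \<Rightarrow> ereal" where
  "deriv_on f A h = (SUP y\<in>A. clarke_deriv f y h)"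

definition optimal_descent_direction ::
    "('a::real_normed_vector \<Rightarrow> real) \<Rightarrow> 'a set \<Rightarrow> 'a \<Rightarrow> bool" where
  "optimal_descent_direction f A h \<longleftrightarrow>
     norm h = 1 \<and> (\<forall>k. norm k \<le> 1 \<longrightarrow> deriv_on f A h \<le> deriv_on f A k) \<and> deriv_on f A h < 0"

definition minimal_norm_element :: "'a::real_normed_vector set \<Rightarrow> 'a \<Rightarrow> bool" where
  "minimal_norm_element S a \<longleftrightarrow> a \<in> S \<and> (\<forall>b\<in>S. norm a \<le> norm b)"

end

theory Submission imports Defs begin

text \<open>
  The support function of the gradient on \<open>A\<close> is the sublinear function \<open>s = deriv_on f A\<close>, and
  by separation in the weak* topology (reflexivity turns functionals on the dual into points) the
  gradient is exactly the set \<open>K\<close> of functionals dominated by \<open>s\<close>.  Every Hahn-Banach step is an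
  instance of the Mazur-Orlicz theorem, whose linear functional is a minimal sublinear function.
  A functional of least norm \<open>d\<close> in \<open>K\<close> comes from Mazur-Orlicz on the product space, so no
  weak* compactness is needed.  Applied to the dual norm and \<open>K\<close>, the theorem yields a vector
  \<open>g\<close> of the unit ball on which all of \<open>K\<close> is at least \<open>d\<close>; then \<open>s (- g) = - d\<close>, which is
  the least value of \<open>s\<close> on the unit ball since the least-norm functional bounds \<open>s\<close> from below.
  Uniqueness on both sides is strict convexity.
\<close>

subsection \<open>Sublinear functions and the Mazur-Orlicz theorem\<close>

definition sublinear :: "('a::real_vector \<Rightarrow> real) \<Rightarrow> bool" where
  "sublinear p \<longleftrightarrow> (\<forall>x y. p (x + y) \<le> p x + p y) \<and> (\<forall>t\<ge>0. \<forall>x. p (t *\<^sub>R x) = t * p x)"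

text \<open>The inequality for \<open>1/t\<close> at \<open>t *\<^sub>R x\<close> reverses the one
  for \<open>t\<close>, and the factors \<open>2\<close> and \<open>1/2\<close> at the origin force
  \<open>p 0 = 0\<close>.\<close>

lemma sublinearI:
  assumes add: "\<And>x y. p (x + y) \<le> p x + p y"
    and scale: "\<And>t x. t > 0 \<Longrightarrow> p (t *\<^sub>R x) \<le> t * p x"
  shows "sublinear p"
proof -
  have "p 0 \<le> 2 * p 0" "p 0 \<le> (1/2) * p 0"
    using scale[of 2 0] scale[of "1/2" 0] by simp_all
  then have zero: "p 0 = 0" by simp
  have "p (t *\<^sub>R x) = t * p x" if t: "t > 0" for t x
  proof (rule antisym[OF scale[OF t]])
    have "p ((1/t) *\<^sub>R t *\<^sub>R x) \<le> (1/t) * p (t *\<^sub>R x)"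
      using t by (intro scale) simp
    then show "t * p x \<le> p (t *\<^sub>R x)"
      using t by (simp add: field_simps)
  qed
  then have "p (t *\<^sub>R x) = t * p x" if "t \<ge> 0" for t x
    using that zero by (cases "t = 0") auto
  with add show ?thesis
    by (simp add: sublinear_def)
qed

lemma sublinear_add: "sublinear p \<Longrightarrow> p (x + y) \<le> p x + p y"
  by (simp add: sublinear_def)

lemma sublinear_scale: "sublinear p \<Longrightarrow> 0 \<le> t \<Longrightarrow> p (t *\<^sub>R x) = t * p x"
  by (simp add: sublinear_def)

lemma sublinear_zero: "sublinear p \<Longrightarrow> p 0 = 0"
  using sublinear_scale[of p 0 0] by simp

lemma sublinear_minus: "sublinear p \<Longrightarrow> - p (- x) \<le> p x"
  using sublinear_add[of p x "- x"] sublinear_zero[of p] by simp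

lemma sublinear_norm: "sublinear norm"
  by (simp add: sublinear_def norm_triangle_ineq)

text \<open>The witness is the infimum of \<open>p (b + t *\<^sub>R a) - t * c\<close> over
  \<open>t \<ge> 0\<close> and \<open>a \<in> K\<close>. Taking \<open>t = 0\<close> puts it below
  \<open>p\<close>; taking \<open>b = - a\<close> and \<open>t = 1\<close> gives the bound on
  \<open>- K\<close>. An odd function below \<open>q\<close> is then at least \<open>c\<close> on
  \<open>K\<close>.\<close>

lemma sublinear_tilt:
  assumes p: "sublinear p" and K: "convex K" "K \<noteq> {}" and c: "\<And>a. a \<in> K \<Longrightarrow> c \<le> p a"
  shows "\<exists>q. sublinear q \<and> (\<forall>x. q x \<le> p x) \<and> (\<forall>a\<in>K. q (- a) \<le> - c)"
proof -
  define S where "S b = {p (b + t *\<^sub>R a) - t * c | t a. 0 \<le> t \<and> a \<in> K}" for b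
  define q where "q b = Inf (S b)" for b
  have ne: "S b \<noteq> {}" for b
    using K(2) by (force simp: S_def)
  \<comment> \<open>This lower bound makes the infimum a real number; it is where
    \<open>c \<le> p\<close> on \<open>K\<close> is used.\<close>
  have lower: "- p (- b) \<le> v" if v: "v \<in> S b" for v b
  proof -
    obtain t a where ta: "0 \<le> t" "a \<in> K" "v = p (b + t *\<^sub>R a) - t * c"
      using v by (auto simp: S_def)
    have "p (t *\<^sub>R a) \<le> p (b + t *\<^sub>R a) + p (- b)"
      using sublinear_add[OF p, of "b + t *\<^sub>R a" "- b"] by simp
    moreover have "t * c \<le> p (t *\<^sub>R a)"
      using ta c sublinear_scale[OF p] by (simp add: mult_left_mono)
    ultimately show ?thesis
      using ta by simp
  qed
  have q_le: "q b \<le> v" if "v \<in> S b" for v b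
    unfolding q_def using that lower by (intro cInf_lower bdd_belowI) auto
  have q_ge: "w \<le> q b" if "\<And>v. v \<in> S b \<Longrightarrow> w \<le> v" for w b
    unfolding q_def using that by (intro cInf_greatest ne) auto
  have S_add: "\<exists>v\<in>S (b1 + b2). v \<le> v1 + v2" if v: "v1 \<in> S b1" "v2 \<in> S b2" for v1 v2 b1 b2
  proof -
    obtain t1 a1 where 1: "0 \<le> t1" "a1 \<in> K" "v1 = p (b1 + t1 *\<^sub>R a1) - t1 * c"
      using v(1) by (auto simp: S_def)
    obtain t2 a2 where 2: "0 \<le> t2" "a2 \<in> K" "v2 = p (b2 + t2 *\<^sub>R a2) - t2 * c"
      using v(2) by (auto simp: S_def)
    \<comment> \<open>Convexity of \<open>K\<close> merges two tilts into one, at the weighted mean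
      of \<open>a1\<close> and \<open>a2\<close>; if both weights vanish, any point of
      \<open>K\<close> serves.\<close>
    obtain a where a: "a \<in> K" "(t1 + t2) *\<^sub>R a = t1 *\<^sub>R a1 + t2 *\<^sub>R a2"
    proof (cases "t1 + t2 = 0")
      case True
      with 1 2 have "t1 = 0" "t2 = 0" by linarith+
      with 1 that show ?thesis by auto
    next
      case False
      with 1 2 have pos: "t1 + t2 > 0" by linarith
      have "(t1 / (t1 + t2)) *\<^sub>R a1 + (t2 / (t1 + t2)) *\<^sub>R a2 \<in> K"
        using 1 2 pos by (intro convexD[OF K(1)]) (auto simp: add_divide_distrib[symmetric])
      moreover have "(t1 + t2) *\<^sub>R ((t1 / (t1 + t2)) *\<^sub>R a1 + (t2 / (t1 + t2)) *\<^sub>R a2)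
          = t1 *\<^sub>R a1 + t2 *\<^sub>R a2"
        using pos by (simp add: scaleR_right_distrib)
      ultimately show ?thesis using that by blast
    qed
    have "p (b1 + b2 + (t1 + t2) *\<^sub>R a) \<le> p (b1 + t1 *\<^sub>R a1) + p (b2 + t2 *\<^sub>R a2)"
      using sublinear_add[OF p, of "b1 + t1 *\<^sub>R a1" "b2 + t2 *\<^sub>R a2"] a(2)
      by (simp add: ac_simps)
    then have "p (b1 + b2 + (t1 + t2) *\<^sub>R a) - (t1 + t2) * c \<le> v1 + v2"
      using 1 2 by (simp add: algebra_simps)
    moreover have "p (b1 + b2 + (t1 + t2) *\<^sub>R a) - (t1 + t2) * c \<in> S (b1 + b2)"
      using 1 2 a unfolding S_def by (metis (mono_tags, lifting) add_nonneg_nonneg mem_Collect_eq)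
    ultimately show ?thesis by blast
  qed
  have "sublinear q"
  proof (rule sublinearI)
    fix b1 b2
    have "q (b1 + b2) - v2 \<le> q b1" if "v2 \<in> S b2" for v2
    proof (rule q_ge)
      fix v1 assume "v1 \<in> S b1"
      then obtain v where "v \<in> S (b1 + b2)" "v \<le> v1 + v2"
        using S_add \<open>v2 \<in> S b2\<close> by blast
      then show "q (b1 + b2) - v2 \<le> v1"
        using q_le by fastforce
    qed
    then have "q (b1 + b2) - q b1 \<le> q b2"
      by (intro q_ge) (smt (verit))
    then show "q (b1 + b2) \<le> q b1 + q b2" by simp
  next
    fix s :: real and b assume s: "s > 0"
    have "q (s *\<^sub>R b) / s \<le> q b"
    proof (rule q_ge)
      fix v assume "v \<in> S b"
      then obtain t a where ta: "0 \<le> t" "a \<in> K" "v = p (b + t *\<^sub>R a) - t * c"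
        by (auto simp: S_def)
      have "p (s *\<^sub>R b + (s * t) *\<^sub>R a) = s * p (b + t *\<^sub>R a)"
        using s sublinear_scale[OF p, of s "b + t *\<^sub>R a"] by (simp add: scaleR_right_distrib)
      then have "s * v = p (s *\<^sub>R b + (s * t) *\<^sub>R a) - (s * t) * c"
        using ta by (simp add: right_diff_distrib)
      then have "s * v \<in> S (s *\<^sub>R b)"
        using s ta by (auto simp: S_def intro!: exI[of _ "s * t"] exI[of _ a])
      from q_le[OF this] show "q (s *\<^sub>R b) / s \<le> v"
        using s by (simp add: field_simps)
    qed
    then show "q (s *\<^sub>R b) \<le> s * q b"
      using s by (simp add: field_simps)
  qed
  moreover have "q x \<le> p x" for x
  proof -
    obtain a where "a \<in> K" using K(2) by blast
    then have "p x \<in> S x"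
      by (auto simp: S_def intro!: exI[of _ 0] exI[of _ a])
    then show ?thesis by (rule q_le)
  qed
  moreover have "q (- a) \<le> - c" if "a \<in> K" for a
  proof -
    have "- c \<in> S (- a)"
      using that sublinear_zero[OF p] by (auto simp: S_def intro!: exI[of _ 1] exI[of _ a])
    then show ?thesis by (rule q_le)
  qed
  ultimately show ?thesis by blast
qed

text \<open>Zorn's lemma for the reversed pointwise order, so that its maximal elements are minimal
  functions. A chain is bounded by its pointwise infimum, which is finite because
  \<open>- p (- x)\<close> lies below every member.\<close>

lemma ex_minimal_sublinear:
  assumes p: "sublinear p"
  shows "\<exists>m. sublinear m \<and> (\<forall>x. m x \<le> p x) \<and>
           (\<forall>q. sublinear q \<longrightarrow> (\<forall>x. q x \<le> m x) \<longrightarrow> q = m)"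
proof -
  define Q where "Q = {q. sublinear q \<and> (\<forall>x. q x \<le> p x)}"
  define R where "R q r \<longleftrightarrow> (\<forall>x. r x \<le> q x)" for q r :: "'a \<Rightarrow> real"
  have "\<exists>m\<in>Q. \<forall>q\<in>Q. R m q \<longrightarrow> q = m"
  proof (rule predicate_Zorn)
    show "partial_order_on Q (relation_of R Q)"
      by (rule partial_order_on_relation_ofI) (auto simp: R_def intro: order_trans intro!: ext antisym)
  next
    fix C assume C: "C \<in> Chains (relation_of R Q)"
    have CQ: "C \<subseteq> Q" using C by (rule Chains_relation_of)
    have chain: "R q r \<or> R r q" if "q \<in> C" "r \<in> C" for q r
      using C that by (auto simp: Chains_def relation_of_def)
    show "\<exists>u\<in>Q. \<forall>q\<in>C. R q u"
    proof (cases "C = {}")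
      case True
      then show ?thesis using p by (auto simp: Q_def)
    next
      case False
      define u where "u x = (INF q\<in>C. q x)" for x
      have "- p (- x) \<le> q x" if "q \<in> C" for q x
      proof -
        have "sublinear q" "q (- x) \<le> p (- x)" using that CQ by (auto simp: Q_def)
        then show ?thesis using sublinear_minus[of q x] by simp
      qed
      then have u_le: "u x \<le> q x" if "q \<in> C" for q x
        unfolding u_def using that by (intro cINF_lower bdd_belowI) auto
      have u_ge: "w \<le> u x" if "\<And>q. q \<in> C \<Longrightarrow> w \<le> q x" for w x
        unfolding u_def using that False by (intro cINF_greatest) auto
      have "sublinear u"
      proof (rule sublinearI)
        fix x y
        \<comment> \<open>Two members of a chain are comparable, and subadditivity of the smaller
          one gives the mixed bound.\<close>
        have *: "u (x + y) \<le> q x + r y" if qr: "q \<in> C" "r \<in> C" for q r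
        proof -
          have sub: "sublinear q" "sublinear r" using qr CQ by (auto simp: Q_def)
          have "u (x + y) \<le> q (x + y)" "u (x + y) \<le> r (x + y)" using qr u_le by auto
          moreover have "q (x + y) \<le> q x + q y" "r (x + y) \<le> r x + r y"
            using sub by (auto simp: sublinear_add)
          moreover have "q y \<le> r y \<or> r x \<le> q x" using chain[OF qr] by (auto simp: R_def)
          ultimately show ?thesis by linarith
        qed
        have "u (x + y) - r y \<le> u x" if "r \<in> C" for r
          using *[OF _ that] by (intro u_ge) (simp add: algebra_simps)
        then have "u (x + y) - u x \<le> u y"
          by (intro u_ge) (smt (verit))
        then show "u (x + y) \<le> u x + u y" by simp
      next
        fix t :: real and x assume t: "t > 0"
        have "u (t *\<^sub>R x) / t \<le> u x"
        proof (rule u_ge)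
          fix q assume q: "q \<in> C"
          then have "q (t *\<^sub>R x) = t * q x"
            using t CQ by (auto simp: Q_def sublinear_scale)
          with u_le[OF q, of "t *\<^sub>R x"] t show "u (t *\<^sub>R x) / t \<le> q x"
            by (simp add: field_simps)
        qed
        with t show "u (t *\<^sub>R x) \<le> t * u x" by (simp add: field_simps)
      qed
      moreover have "u x \<le> p x" for x
      proof -
        obtain q where q: "q \<in> C" using False by blast
        then have "q x \<le> p x" using CQ by (auto simp: Q_def)
        with u_le[OF q, of x] show ?thesis by simp
      qed
      ultimately show ?thesis using u_le by (auto simp: Q_def R_def)
    qed
  qed
  then obtain m where "m \<in> Q" and min: "\<And>q. q \<in> Q \<Longrightarrow> R m q \<Longrightarrow> q = m" by blast
  moreover have "q = m" if "sublinear q" "\<forall>x. q x \<le> m x" for q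
    using that \<open>m \<in> Q\<close> by (intro min) (auto simp: Q_def R_def intro: order_trans)
  ultimately show ?thesis by (auto simp: Q_def)
qed

text \<open>Tilting first puts the constraint on \<open>K\<close> into \<open>q\<close>, and any
  linear functional below \<open>q\<close> inherits it. For \<open>K = {h}\<close> and
  \<open>c = p h\<close> this is the Hahn-Banach theorem.\<close>

theorem mazur_orlicz:
  assumes p: "sublinear p" and K: "convex K" "K \<noteq> {}" and c: "\<And>a. a \<in> K \<Longrightarrow> c \<le> p a"
  shows "\<exists>l. linear l \<and> (\<forall>x. l x \<le> p x) \<and> (\<forall>a\<in>K. c \<le> l a)"
proof -
  obtain q where q: "sublinear q" "\<And>x. q x \<le> p x" "\<And>a. a \<in> K \<Longrightarrow> q (- a) \<le> - c"
    using sublinear_tilt[OF assms] by blast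
  obtain m where m: "sublinear m" "\<And>x. m x \<le> q x"
    and min: "\<And>r. sublinear r \<Longrightarrow> \<forall>x. r x \<le> m x \<Longrightarrow> r = m"
    using ex_minimal_sublinear[OF q(1)] by blast
  txt \<open>Tilting \<open>m\<close> along a single vector cannot decrease it, so \<open>m\<close> is odd, hence linear.\<close>
  have odd: "m (- x) = - m x" for x
  proof -
    obtain r where r: "sublinear r" "\<forall>y. r y \<le> m y" "r (- x) \<le> - m x"
      using sublinear_tilt[OF m(1), of "{x}" "m x"] by auto
    with min have "m (- x) \<le> - m x" by blast
    with sublinear_minus[OF m(1), of x] show ?thesis by simp
  qed
  have "linear m"
  proof (rule linearI)
    fix x y
    have "m (- x + - y) \<le> m (- x) + m (- y)" by (rule sublinear_add[OF m(1)])
    then have "m x + m y \<le> m (x + y)" using odd[of "x + y"] by (simp add: odd)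
    with sublinear_add[OF m(1), of x y] show "m (x + y) = m x + m y" by simp
  next
    fix t x
    show "m (t *\<^sub>R x) = t *\<^sub>R m x"
      using sublinear_scale[OF m(1), of t x] sublinear_scale[OF m(1), of "- t" x] odd[of "t *\<^sub>R x"]
      by (cases "t \<ge> 0") auto
  qed
  moreover have "m x \<le> p x" for x using m(2)[of x] q(2)[of x] by simp
  moreover have "c \<le> m a" if "a \<in> K" for a
    using m(2)[of "- a"] q(3)[OF that] odd[of a] by simp
  ultimately show ?thesis by blast
qed

subsection \<open>Duality in reflexive and strictly convex spaces\<close>

lemma dominated_linear_blinfun:
  fixes l :: "'a::real_normed_vector \<Rightarrow> real"
  assumes l: "linear l" and le: "\<And>x. l x \<le> M * norm x" and M: "M \<ge> 0"
  shows "\<exists>b :: 'a dual. blinfun_apply b = l \<and> norm b \<le> M"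
proof -
  have "norm (l x) \<le> M * norm x" for x
    using le[of x] le[of "- x"] linear_neg[OF l, of x] by auto
  moreover from this have "bounded_linear l"
    using l by (intro bounded_linear_intro[of _ M]) (auto simp: linear_iff mult.commute)
  ultimately show ?thesis
    using M by (intro exI[of _ "Blinfun l"]) (auto simp: bounded_linear_Blinfun_apply intro: norm_blinfun_bound)
qed

text \<open>Mazur-Orlicz for the singleton \<open>{h}\<close>: a sublinear function is the pointwise
  maximum of the functionals it dominates.\<close>

lemma sublinear_attained:
  fixes p :: "'a::real_normed_vector \<Rightarrow> real"
  assumes p: "sublinear p" and le: "\<And>x. p x \<le> M * norm x" and M: "M \<ge> 0"
  shows "\<exists>b :: 'a dual. norm b \<le> M \<and> (\<forall>x. blinfun_apply b x \<le> p x) \<and> blinfun_apply b h = p h"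
proof -
  obtain l where l: "linear l" "\<And>x. l x \<le> p x" "p h \<le> l h"
    using mazur_orlicz[OF p, of "{h}" "p h"] by auto
  moreover have "l x \<le> M * norm x" for x
    using l(2)[of x] le[of x] by simp
  ultimately obtain b :: "'a dual" where "blinfun_apply b = l" "norm b \<le> M"
    using dominated_linear_blinfun[of l M] M by blast
  with l show ?thesis by (metis order_antisym)
qed

lemma norm_le_of_dual_bound:
  fixes h :: "'a::real_normed_vector"
  assumes "\<And>\<phi> :: 'a dual. norm \<phi> \<le> 1 \<Longrightarrow> blinfun_apply \<phi> h \<le> r"
  shows "norm h \<le> r"
  using sublinear_attained[OF sublinear_norm, of 1 h] assms by fastforce

text \<open>Reflexivity gives the point \<open>x\<close>; its norm bound comes from testing
  \<open>x\<close> against the unit ball of the dual.\<close>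

lemma reflexive_space_represent:
  fixes l :: "'a::real_normed_vector dual \<Rightarrow> real"
  assumes R: "reflexive_space TYPE('a)" and l: "linear l" "\<And>\<phi>. l \<phi> \<le> M * norm \<phi>" and M: "M \<ge> 0"
  shows "\<exists>x. norm x \<le> M \<and> (\<forall>\<phi>. l \<phi> = blinfun_apply \<phi> x)"
proof -
  obtain b :: "'a dual dual" where "blinfun_apply b = l"
    using dominated_linear_blinfun[OF l M] by blast
  with R obtain x where x: "\<And>\<phi>. l \<phi> = blinfun_apply \<phi> x"
    unfolding reflexive_space_def by metis
  have "norm x \<le> M"
  proof (rule norm_le_of_dual_bound)
    fix \<phi> :: "'a dual" assume "norm \<phi> \<le> 1"
    then have "M * norm \<phi> \<le> M" using M by (simp add: mult_left_le)
    with l(2)[of \<phi>] x[of \<phi>] show "blinfun_apply \<phi> x \<le> M" by simp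
  qed
  with x show ?thesis by blast
qed

section \<open>Separation in the weak* topology\<close>

text \<open>A basic box of the product topology constrains only finitely many coordinates, so one
  radius fits all of them.\<close>

lemma openin_weak_star_contains_basic:
  fixes a :: "'a::real_normed_vector dual"
  assumes U: "openin weak_star_topology U" "a \<in> U"
  shows "\<exists>I e. finite I \<and> 0 < e \<and> (\<forall>b. (\<forall>x\<in>I. \<bar>blinfun_apply (b - a) x\<bar> < e) \<longrightarrow> b \<in> U)"
proof -
  obtain V where V: "open V" "U = blinfun_apply -` V"
    using U(1) unfolding weak_star_topology_def strong_operator_topology_def
      openin_pullback_topology open_openin[symmetric] Int_UNIV_right by blast
  have "openin (product_topology (\<lambda>i. euclidean) UNIV) V"
    using V(1) by (simp add: euclidean_product_topology)
  moreover have "blinfun_apply a \<in> V" using U(2) V(2) by simp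
  ultimately obtain X where X: "blinfun_apply a \<in> (\<Pi>\<^sub>E i\<in>UNIV. X i)"
    "\<And>i. open (X i)" "finite {i. X i \<noteq> UNIV}" "(\<Pi>\<^sub>E i\<in>UNIV. X i) \<subseteq> V"
    using product_topology_open_contains_basis[of "\<lambda>i. euclidean" UNIV V "blinfun_apply a"]
    unfolding topspace_euclidean open_openin[symmetric] by blast
  define I where "I = {i. X i \<noteq> UNIV}"
  have "\<exists>e>0. ball (blinfun_apply a i) e \<subseteq> X i" for i
    using X(1) X(2)[of i] by (auto simp: PiE_def open_contains_ball)
  then obtain e where e: "\<And>i. 0 < e i" "\<And>i. ball (blinfun_apply a i) (e i) \<subseteq> X i"
    by metis
  \<comment> \<open>The inserted \<open>1\<close> keeps the minimum meaningful when \<open>I\<close>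
    is empty.\<close>
  define d where "d = Min (insert 1 (e ` I))"
  have fin: "finite I" using X(3) by (simp add: I_def)
  have "0 < d" using fin e by (simp add: d_def)
  moreover have "b \<in> U" if b: "\<forall>x\<in>I. \<bar>blinfun_apply (b - a) x\<bar> < d" for b
  proof -
    have "blinfun_apply b i \<in> X i" for i
    proof (cases "i \<in> I")
      case True
      then have "d \<le> e i" using fin by (simp add: d_def)
      with b True have "\<bar>blinfun_apply b i - blinfun_apply a i\<bar> < e i"
        by (force simp: blinfun.diff_left)
      then have "blinfun_apply b i \<in> ball (blinfun_apply a i) (e i)"
        by (simp add: dist_real_def abs_minus_commute)
      with e(2) show ?thesis by blast
    qed (auto simp: I_def)
    with X(4) V(2) show ?thesis by (auto simp: PiE_def)
  qed
  ultimately show ?thesis using fin by blast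
qed

lemma closedin_weak_star_halfspace:
  "closedin weak_star_topology {a. blinfun_apply a h \<le> c}"
proof -
  have "closedin weak_star_topology
      {a \<in> topspace weak_star_topology. blinfun_apply a h \<in> {..c}}"
    unfolding weak_star_topology_def
    by (rule closedin_continuous_map_preimage[OF strong_operator_topology_continuous_evaluation])
       (simp flip: closed_closedin)
  then show ?thesis
    by (simp add: weak_star_topology_def strong_operator_topology_topspace)
qed

text \<open>A basic neighborhood of \<open>a\<close> missing \<open>C\<close> makes the seminorm
  \<open>p\<close> at least \<open>e\<close> on \<open>a - C\<close>. Mazur-Orlicz turns this into a
  linear functional with the same bound; as \<open>p\<close> is dominated by a multiple of the dual
  norm, reflexivity represents that functional by a vector \<open>h\<close>.\<close>

lemma weak_star_closure_separation:
  fixes a :: "'a::real_normed_vector dual"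
  assumes R: "reflexive_space TYPE('a)" and C: "convex C" "C \<noteq> {}"
    and a: "a \<notin> weak_star_topology closure_of C"
  shows "\<exists>h e. 0 < e \<and> (\<forall>b\<in>C. blinfun_apply b h + e \<le> blinfun_apply a h)"
proof -
  obtain U where U: "openin weak_star_topology U" "a \<in> U" "U \<inter> C = {}"
    using a by (auto simp: in_closure_of weak_star_topology_def strong_operator_topology_topspace)
  obtain I e where I: "finite I" "0 < e"
    and nbhd: "\<And>b. \<forall>x\<in>I. \<bar>blinfun_apply (b - a) x\<bar> < e \<Longrightarrow> b \<in> U"
    using openin_weak_star_contains_basic[OF U(1,2)] by blast
  define p where "p b = (\<Sum>x\<in>I. \<bar>blinfun_apply b x\<bar>)" for b :: "'a dual"
  have p: "sublinear p"
    by (rule sublinearI)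
      (auto simp: p_def blinfun.add_left blinfun.scaleR_left abs_mult sum_distrib_left
            simp flip: sum.distrib intro!: sum_mono)
  have p_le: "p b \<le> (\<Sum>x\<in>I. norm x) * norm b" for b
    unfolding p_def sum_distrib_right using norm_blinfun[of b]
    by (intro sum_mono) (simp add: mult.commute)
  have "e \<le> p b" if "b \<in> (\<lambda>b. a - b) ` C" for b
  proof -
    have "a - b \<notin> U" using that U(3) by auto
    then obtain x where x: "x \<in> I" "e \<le> \<bar>blinfun_apply b x\<bar>"
      using nbhd[of "a - b"] by (force simp: blinfun.minus_left)
    have "\<bar>blinfun_apply b x\<bar> \<le> p b"
      unfolding p_def using I x by (intro member_le_sum) auto
    with x show ?thesis by simp
  qed
  moreover have "convex ((\<lambda>b. a - b) ` C)"
    using convex_translation[OF convex_negations[OF C(1)], of a]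
    by (simp add: image_image)
  ultimately obtain l where l: "linear l" "\<And>b. l b \<le> p b" "\<And>b. b \<in> C \<Longrightarrow> e \<le> l (a - b)"
    using mazur_orlicz[OF p, of "(\<lambda>b. a - b) ` C" e] C(2) by auto
  have "l b \<le> (\<Sum>x\<in>I. norm x) * norm b" for b
    using l(2)[of b] p_le[of b] by simp
  then obtain h where "\<And>b. l b = blinfun_apply b h"
    using reflexive_space_represent[OF R l(1)] by (metis norm_ge_zero sum_nonneg)
  with l(3) I(2) show ?thesis
    by (intro exI[of _ h] exI[of _ e]) (fastforce simp: blinfun.diff_left)
qed

section \<open>Least-norm functionals and common lower directions\<close>

lemma ex_minimal_norm_dominated:
  fixes s :: "'a::real_normed_vector \<Rightarrow> real"
  assumes s: "sublinear s" and le: "\<And>x. s x \<le> M * norm x" and M: "M \<ge> 0"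
  shows "\<exists>a :: 'a dual. minimal_norm_element {a. \<forall>h. blinfun_apply a h \<le> s h} a"
proof -
  define K where "K = {a :: 'a dual. \<forall>h. blinfun_apply a h \<le> s h}"
  define d where "d = (INF a\<in>K. norm a)"
  have ne: "K \<noteq> {}"
    using sublinear_attained[OF s le M] by (auto simp: K_def)
  have d_le: "d \<le> norm a" if "a \<in> K" for a
    unfolding d_def using that by (intro cINF_lower bdd_belowI[of _ 0]) auto
  have d_ge: "w \<le> d" if "\<And>a. a \<in> K \<Longrightarrow> w \<le> norm a" for w
    unfolding d_def using ne that by (intro cINF_greatest) auto
  have d0: "0 \<le> d" by (rule d_ge) simp
  \<comment> \<open>Each \<open>a \<in> K\<close> satisfies
    \<open>- norm a * norm h \<le> s h\<close>, and the infimum over \<open>K\<close> preserves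
    this. It is the compatibility condition for a linear functional between
    \<open>- d * norm\<close> and \<open>s\<close>; such a functional has norm at most
    \<open>d\<close>, so the infimum is attained.\<close>
  have nonneg: "0 \<le> s h + d * norm h" for h
  proof (cases "h = 0")
    case True
    then show ?thesis using sublinear_zero[OF s] by simp
  next
    case False
    have "- s h / norm h \<le> d"
    proof (rule d_ge)
      fix a assume "a \<in> K"
      then have "blinfun_apply a h \<le> s h" by (simp add: K_def)
      with norm_blinfun[of a h] have "- s h \<le> norm a * norm h" by simp
      with False show "- s h / norm h \<le> norm a" by (simp add: field_simps)
    qed
    with False show ?thesis by (simp add: field_simps)
  qed
  txt \<open>A sandwich argument: a linear functional on the product that is dominated by \<open>p\<close> and
    nonnegative on the diagonal splits into \<open>(a, b)\<close> with \<open>a \<le> s\<close>, \<open>b \<le> d * norm\<close> and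
    \<open>- a \<le> b\<close>.\<close>
  define p where "p z = s (fst z) + d * norm (snd z)" for z :: "'a \<times> 'a"
  have p: "sublinear p"
  proof (rule sublinearI)
    fix x y :: "'a \<times> 'a"
    have "d * norm (snd x + snd y) \<le> d * (norm (snd x) + norm (snd y))"
      using d0 by (intro mult_left_mono norm_triangle_ineq)
    with sublinear_add[OF s, of "fst x" "fst y"] show "p (x + y) \<le> p x + p y"
      by (simp add: p_def algebra_simps)
  qed (simp add: p_def sublinear_scale[OF s] algebra_simps)
  have "convex (range (\<lambda>k :: 'a. (k, k)))"
    by (rule subspace_imp_convex[OF linear_subspace_image[OF _ subspace_UNIV]])
       (auto intro!: linearI)
  moreover have "0 \<le> p z" if "z \<in> range (\<lambda>k. (k, k))" for z
    using that nonneg by (auto simp: p_def)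
  ultimately obtain l where l: "linear l" "\<And>z. l z \<le> p z" "\<And>k. 0 \<le> l (k, k)"
    using mazur_orlicz[OF p, of "range (\<lambda>k. (k, k))" 0] by blast
  define a where "a x = l (x, 0)" for x
  have lin: "linear a"
  proof (rule linearI)
    show "a (x + y) = a x + a y" for x y
      using linear_add[OF l(1), of "(x, 0)" "(y, 0)"] by (simp add: a_def)
    show "a (t *\<^sub>R x) = t *\<^sub>R a x" for t x
      using linear_scale[OF l(1), of t "(x, 0)"] by (simp add: a_def)
  qed
  have a_s: "a x \<le> s x" for x
    using l(2)[of "(x, 0)"] by (simp add: a_def p_def)
  have a_ge: "- (d * norm x) \<le> a x" for x
  proof -
    have "l (x, x) = a x + l (0, x)"
      using linear_add[OF l(1), of "(x, 0)" "(0, x)"] by (simp add: a_def)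
    with l(3)[of x] l(2)[of "(0, x)"] show ?thesis
      using sublinear_zero[OF s] by (simp add: p_def)
  qed
  have "a x \<le> d * norm x" for x
    using a_ge[of "- x"] linear_neg[OF lin, of x] by simp
  then obtain b :: "'a dual" where b: "blinfun_apply b = a" "norm b \<le> d"
    using dominated_linear_blinfun[OF lin _ d0] by blast
  with a_s have "b \<in> K" by (simp add: K_def)
  with b d_le have "minimal_norm_element K b"
    unfolding minimal_norm_element_def by (meson order_trans)
  then show ?thesis by (auto simp: K_def)
qed

text \<open>Mazur-Orlicz on the dual space, with its norm as the sublinear function, gives one
  functional that is at least \<open>d\<close> on all of \<open>K\<close>; reflexivity makes it a
  vector of the unit ball.\<close>

lemma ex_common_lower_direction:
  fixes K :: "'a::real_normed_vector dual set"
  assumes R: "reflexive_space TYPE('a)" and K: "convex K" "K \<noteq> {}"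
    and d: "\<And>a. a \<in> K \<Longrightarrow> d \<le> norm a"
  shows "\<exists>h. norm h \<le> 1 \<and> (\<forall>a\<in>K. d \<le> blinfun_apply a h)"
proof -
  obtain l where l: "linear l" "\<And>a. l a \<le> norm a" "\<And>a. a \<in> K \<Longrightarrow> d \<le> l a"
    using mazur_orlicz[OF sublinear_norm K d] by blast
  then show ?thesis
    using reflexive_space_represent[OF R l(1), of 1] by force
qed

section \<open>Uniqueness from strict convexity\<close>

lemma strictly_convex_midpoint:
  fixes x y :: "'b::real_normed_vector"
  assumes "strictly_convex_space TYPE('b)" "norm x = 1" "norm y = 1" "x \<noteq> y"
  shows "norm ((1/2) *\<^sub>R x + (1/2) *\<^sub>R y) < 1"
proof -
  have "norm ((1 - 1/2) *\<^sub>R x + (1/2) *\<^sub>R y) < 1"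
    using assms(2-4) by (intro assms(1)[unfolded strictly_convex_space_def, rule_format]) auto
  then show ?thesis by simp
qed

text \<open>Two distinct minimizers have a common norm \<open>d > 0\<close>. After scaling to the
  unit sphere, strict convexity gives their midpoint a norm below \<open>d\<close>, although it lies
  in \<open>S\<close>.\<close>

lemma minimal_norm_element_unique:
  fixes S :: "'b::real_normed_vector set"
  assumes SC: "strictly_convex_space TYPE('b)" and S: "convex S"
    and a: "minimal_norm_element S a" and b: "minimal_norm_element S b"
  shows "a = b"
proof (rule ccontr)
  assume "a \<noteq> b"
  define d where "d = norm a"
  have d: "norm a = d" "norm b = d"
    using a b by (auto simp: minimal_norm_element_def d_def intro: antisym)
  with \<open>a \<noteq> b\<close> have pos: "d > 0"
    by (metis norm_eq_zero zero_less_norm_iff)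
  have "norm ((1/2) *\<^sub>R ((1/d) *\<^sub>R a) + (1/2) *\<^sub>R ((1/d) *\<^sub>R b)) < 1"
    using \<open>a \<noteq> b\<close> d pos by (intro strictly_convex_midpoint[OF SC]) auto
  moreover have "(1/2) *\<^sub>R ((1/d) *\<^sub>R a) + (1/2) *\<^sub>R ((1/d) *\<^sub>R b)
      = (1/d) *\<^sub>R ((1/2) *\<^sub>R a + (1/2) *\<^sub>R b)"
    by (simp add: scaleR_right_distrib mult.commute)
  ultimately have "(1/d) * norm ((1/2) *\<^sub>R a + (1/2) *\<^sub>R b) < 1"
    using pos by (simp only: norm_scaleR) simp
  then have "norm ((1/2) *\<^sub>R a + (1/2) *\<^sub>R b) < d"
    using pos by (simp add: pos_divide_less_eq del: scaleR_half_double)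
  moreover have "(1/2) *\<^sub>R a + (1/2) *\<^sub>R b \<in> S"
    using a b by (intro convexD[OF S]) (auto simp: minimal_norm_element_def)
  ultimately show False
    using a d by (fastforce simp: minimal_norm_element_def)
qed

text \<open>The midpoint of two such directions still has value \<open>- norm a\<close>, but its
  norm is below \<open>1\<close>, contradicting the operator norm bound.\<close>

lemma norm_attaining_direction_unique:
  fixes a :: "'a::real_normed_vector dual"
  assumes SC: "strictly_convex_space TYPE('a)" and a: "a \<noteq> 0"
    and h: "norm h = 1" "blinfun_apply a h = - norm a"
    and k: "norm k = 1" "blinfun_apply a k = - norm a"
  shows "h = k"
proof (rule ccontr)
  assume "h \<noteq> k"
  define m where "m = (1/2 :: real) *\<^sub>R h + (1/2 :: real) *\<^sub>R k"
  have "norm m < 1"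
    unfolding m_def using SC h(1) k(1) \<open>h \<noteq> k\<close> by (rule strictly_convex_midpoint)
  then have "norm a * norm m < norm a" using a by simp
  moreover have "blinfun_apply a m = - norm a"
    using h k by (simp add: m_def blinfun.add_right blinfun.scaleR_right)
  ultimately show False
    using norm_blinfun[of a m] by simp
qed

lemma convex_dominated: "convex {b :: 'a::real_normed_vector dual. \<forall>h. blinfun_apply b h \<le> s h}"
  by (rule convexI) (auto simp: blinfun.add_left blinfun.scaleR_left intro: convex_bound_le)

section \<open>Steepest descent for a sublinear function\<close>

text \<open>Two bounds meet at \<open>- g\<close>: domination of \<open>a\<close> by
  \<open>s\<close> gives \<open>- norm a \<le> s k\<close> on the unit ball, while the functional in
  \<open>K\<close> attaining \<open>s (- g)\<close> gives
  \<open>s (- g) \<le> - norm a\<close>.\<close>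

lemma optimal_descent_of_sublinear:
  fixes s :: "'a::real_normed_vector \<Rightarrow> real" and a :: "'a dual"
  assumes R: "reflexive_space TYPE('a)" and SC: "strictly_convex_space TYPE('a)"
    and s: "sublinear s" and le: "\<And>x. s x \<le> M * norm x" and M: "M \<ge> 0"
    and a: "minimal_norm_element {b. \<forall>h. blinfun_apply b h \<le> s h} a" and a0: "a \<noteq> 0"
  shows "\<exists>h. norm h = 1 \<and> blinfun_apply a h = - norm a"
    and "(norm h = 1 \<and> (\<forall>k. norm k \<le> 1 \<longrightarrow> s h \<le> s k) \<and> s h < 0) \<longleftrightarrow>
         (blinfun_apply a h = - norm a \<and> norm h = 1)"
proof -
  define K where "K = {b :: 'a dual. \<forall>h. blinfun_apply b h \<le> s h}"
  have aK: "a \<in> K" and min: "\<And>b. b \<in> K \<Longrightarrow> norm a \<le> norm b"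
    using a by (auto simp: minimal_norm_element_def K_def)
  have "convex K" unfolding K_def by (rule convex_dominated)
  then obtain g where g: "norm g \<le> 1" "\<And>b. b \<in> K \<Longrightarrow> norm a \<le> blinfun_apply b g"
    using ex_common_lower_direction[OF R _ _ min] aK by blast
  have pos: "norm a > 0" using a0 by simp
  have lower: "- norm a \<le> blinfun_apply a k" if "norm k \<le> 1" for k
  proof -
    have "norm a * norm k \<le> norm a" using that by (simp add: mult_left_le)
    with norm_blinfun[of a k] show ?thesis by simp
  qed
  have "s (- g) \<le> - norm a"
  proof -
    obtain b :: "'a dual" where "b \<in> K" "blinfun_apply b (- g) = s (- g)"
      using sublinear_attained[OF s le M, of "- g"] by (auto simp: K_def)
    with g(2)[of b] show ?thesis by (simp add: blinfun.minus_right)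
  qed
  moreover have a_le: "blinfun_apply a k \<le> s k" for k
    using aK by (simp add: K_def)
  moreover have "- norm a \<le> blinfun_apply a (- g)"
    using lower[of "- g"] g(1) by simp
  ultimately have sg: "s (- g) = - norm a" "blinfun_apply a (- g) = - norm a"
    using a_le[of "- g"] by linarith+
  \<comment> \<open>Attaining the value \<open>- norm a\<close> forces \<open>g\<close> onto the
    unit sphere.\<close>
  have "norm a \<le> norm a * norm g"
    using norm_blinfun[of a g] sg(2) by (simp add: blinfun.minus_right)
  then have norm_g: "norm (- g) = 1"
    using pos g(1) by simp
  with sg show "\<exists>h. norm h = 1 \<and> blinfun_apply a h = - norm a" by blast
  show "(norm h = 1 \<and> (\<forall>k. norm k \<le> 1 \<longrightarrow> s h \<le> s k) \<and> s h < 0) \<longleftrightarrow>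
         (blinfun_apply a h = - norm a \<and> norm h = 1)" (is "?L \<longleftrightarrow> ?R")
  proof
    assume L: ?L
    \<comment> \<open>Comparison with \<open>- g\<close> closes the chain
      \<open>- norm a \<le> blinfun_apply a h \<le> s h \<le> - norm a\<close>.\<close>
    then have "s h \<le> - norm a" using norm_g sg(1) by (metis order_refl)
    with lower[of h] a_le[of h] L show ?R by simp
  next
    assume ?R
    \<comment> \<open>Strict convexity identifies \<open>h\<close> with the direction already known
      to be optimal.\<close>
    then have "h = - g"
      using norm_attaining_direction_unique[OF SC a0] norm_g sg(2) by blast
    moreover have "s (- g) \<le> s k" if "norm k \<le> 1" for k
      using lower[OF that] a_le[of k] sg(1) by simp
    ultimately show ?L using norm_g sg pos by simp
  qed
qed

subsection \<open>Clarke derivatives of Lipschitz functions\<close>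

text \<open>Rescaling the step size; this change of variables gives positive homogeneity of the
  Clarke derivative.\<close>

lemma filterlim_clarke_scale:
  assumes s: "(s::real) > 0"
  shows "filterlim (\<lambda>(z, t). (z, s * t)) (nhds x \<times>\<^sub>F at_right 0) (nhds x \<times>\<^sub>F at_right 0)"
proof -
  have "filterlim (\<lambda>t. s * t) (at_right 0) (at_right 0)"
    using s by (auto simp: filterlim_at eventually_at_right_less intro!: tendsto_eq_intros
        eventually_mono[OF eventually_at_right_less[of 0]])
  then have "filterlim (\<lambda>w. s * snd w) (at_right 0) (nhds x \<times>\<^sub>F at_right 0)"
    by (rule filterlim_compose) (simp add: filterlim_def filtermap_snd_prod_filter)
  moreover have "filterlim fst (nhds x) (nhds x \<times>\<^sub>F at_right (0::real))"
    by (simp add: filterlim_def filtermap_fst_prod_filter)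
  ultimately show ?thesis
    unfolding case_prod_unfold by (intro filterlim_Pair)
qed

text \<open>Moving the base point along \<open>h\<close>; this keeps difference quotients inside
  \<open>U\<close> and gives subadditivity.\<close>

lemma filterlim_clarke_translate:
  fixes x h :: "'a::real_normed_vector"
  shows "filterlim (\<lambda>(z, t). z + t *\<^sub>R h) (nhds x) (nhds x \<times>\<^sub>F at_right 0)"
proof -
  have "filterlim fst (nhds x) (nhds x \<times>\<^sub>F at_right (0::real))"
    "filterlim snd (at_right (0::real)) (nhds x \<times>\<^sub>F at_right 0)"
    by (simp_all add: filterlim_def filtermap_fst_prod_filter filtermap_snd_prod_filter)
  then have "((\<lambda>w. fst w + snd w *\<^sub>R h) \<longlongrightarrow> x + 0 *\<^sub>R h) (nhds x \<times>\<^sub>F at_right 0)"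
    by (intro tendsto_intros) (auto simp: filterlim_at)
  then show ?thesis by (simp add: case_prod_unfold)
qed

lemma clarke_filter_ne_bot: "nhds (x::'a::real_normed_vector) \<times>\<^sub>F at_right (0::real) \<noteq> bot"
  by (simp add: prod_filter_eq_bot)

section \<open>The Clarke derivative and gradient at a single point\<close>

context
  fixes f :: "'a::real_normed_vector \<Rightarrow> real" and U :: "'a set" and L :: real and x :: 'a
  assumes U: "open U" and L: "L-lipschitz_on U f" and x: "x \<in> U"
begin

lemma clarke_quotient_bound:
  "\<forall>\<^sub>F (z, t) in nhds x \<times>\<^sub>F at_right 0. \<bar>(f (z + t *\<^sub>R h) - f z) / t\<bar> \<le> L * norm h"
proof -
  have nbhd: "\<forall>\<^sub>F z in nhds x. z \<in> U" using U x by (rule eventually_nhds_in_open)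
  have "\<forall>\<^sub>F w in nhds x \<times>\<^sub>F at_right 0. fst w \<in> U \<and> snd w > (0::real)"
    by (rule eventually_prodI[OF nbhd eventually_at_right_less])
  moreover have "\<forall>\<^sub>F (z, t) in nhds x \<times>\<^sub>F at_right 0. z + t *\<^sub>R h \<in> U"
    using eventually_compose_filterlim[OF nbhd filterlim_clarke_translate[of h x]]
    by (simp add: case_prod_unfold)
  ultimately show ?thesis
  proof eventually_elim
    case (elim w)
    obtain z t where w: "w = (z, t)" by (cases w)
    have "dist (f (z + t *\<^sub>R h)) (f z) \<le> L * dist (z + t *\<^sub>R h) z"
      using elim w by (intro lipschitz_onD[OF L]) auto
    then have "\<bar>f (z + t *\<^sub>R h) - f z\<bar> \<le> (L * norm h) * t"
      using elim w by (simp add: dist_norm ac_simps)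
    then show ?case
      using elim w by (simp add: pos_divide_le_eq)
  qed
qed

lemma clarke_deriv_bounds:
  "clarke_deriv f x h \<le> ereal (L * norm h)" "ereal (- (L * norm h)) \<le> clarke_deriv f x h"
proof -
  show "clarke_deriv f x h \<le> ereal (L * norm h)"
    unfolding clarke_deriv_def
    by (intro Limsup_bounded eventually_mono[OF clarke_quotient_bound[of h]]) (auto simp: abs_le_iff minus_le_iff simp del: abs_divide)
  show "ereal (- (L * norm h)) \<le> clarke_deriv f x h"
    unfolding clarke_deriv_def
    by (intro le_Limsup clarke_filter_ne_bot eventually_mono[OF clarke_quotient_bound[of h]]) (auto simp: abs_le_iff minus_le_iff simp del: abs_divide)
qed

lemma clarke_deriv_real: "ereal (real_of_ereal (clarke_deriv f x h)) = clarke_deriv f x h"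
  using clarke_deriv_bounds[of h] by (cases "clarke_deriv f x h") auto

text \<open>Restates the extended-real limit superior as eventual bounds on real quotients, ready
  for a change of variables.\<close>

lemma clarke_deriv_le_iff:
  "real_of_ereal (clarke_deriv f x h) \<le> c \<longleftrightarrow>
     (\<forall>r>c. \<forall>\<^sub>F (z, t) in nhds x \<times>\<^sub>F at_right 0. (f (z + t *\<^sub>R h) - f z) / t < r)"
proof -
  have "real_of_ereal (clarke_deriv f x h) \<le> c \<longleftrightarrow> clarke_deriv f x h \<le> ereal c"
    by (metis clarke_deriv_real ereal_less_eq(3))
  also have "\<dots> \<longleftrightarrow> (\<forall>r>ereal c. \<forall>\<^sub>F (z, t) in nhds x \<times>\<^sub>F at_right 0.
      ereal ((f (z + t *\<^sub>R h) - f z) / t) < r)"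
    unfolding clarke_deriv_def Limsup_le_iff by (simp add: case_prod_unfold)
  also have "\<dots> \<longleftrightarrow>
     (\<forall>r>c. \<forall>\<^sub>F (z, t) in nhds x \<times>\<^sub>F at_right 0. (f (z + t *\<^sub>R h) - f z) / t < r)"
  proof (intro iffI allI impI)
    fix r assume *: "\<forall>r>c. \<forall>\<^sub>F (z, t) in nhds x \<times>\<^sub>F at_right 0. (f (z + t *\<^sub>R h) - f z) / t < r"
      and "ereal c < r"
    with * show "\<forall>\<^sub>F (z, t) in nhds x \<times>\<^sub>F at_right 0. ereal ((f (z + t *\<^sub>R h) - f z) / t) < r"
      by (cases r) (auto simp: case_prod_unfold)
  next
    fix r assume *: "\<forall>r>ereal c. \<forall>\<^sub>F (z, t) in nhds x \<times>\<^sub>F at_right 0.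
        ereal ((f (z + t *\<^sub>R h) - f z) / t) < r" and "c < r"
    show "\<forall>\<^sub>F (z, t) in nhds x \<times>\<^sub>F at_right 0. (f (z + t *\<^sub>R h) - f z) / t < r"
      using *[rule_format, of "ereal r"] \<open>c < r\<close> by (simp add: case_prod_unfold)
  qed
  finally show ?thesis .
qed

text \<open>The quotient for \<open>h + k\<close> at \<open>z\<close> is the one for
  \<open>h\<close> at \<open>z\<close> plus the one for \<open>k\<close> at
  \<open>z + t *\<^sub>R h\<close>, whose base point also tends to \<open>x\<close>. The quotient
  for \<open>s *\<^sub>R h\<close> with step \<open>t\<close> is \<open>s\<close> times the one for
  \<open>h\<close> with step \<open>s * t\<close>.\<close>

lemma sublinear_clarke_deriv: "sublinear (\<lambda>h. real_of_ereal (clarke_deriv f x h))" (is "sublinear ?p")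
proof (rule sublinearI)
  fix h k
  show "?p (h + k) \<le> ?p h + ?p k"
    unfolding clarke_deriv_le_iff
  proof (intro allI impI)
    fix r assume r: "?p h + ?p k < r"
    \<comment> \<open>Half of the slack goes to each of the two quotients.\<close>
    define e where "e = (r - ?p h - ?p k) / 2"
    have e: "e > 0" "?p h + e + (?p k + e) = r" using r by (auto simp: e_def field_simps)
    have h: "\<forall>\<^sub>F (z, t) in nhds x \<times>\<^sub>F at_right 0. (f (z + t *\<^sub>R h) - f z) / t < ?p h + e"
      and k: "\<forall>\<^sub>F (z, t) in nhds x \<times>\<^sub>F at_right 0. (f (z + t *\<^sub>R k) - f z) / t < ?p k + e"
      using clarke_deriv_le_iff[of h "?p h"] clarke_deriv_le_iff[of k "?p k"] e by auto
    have "filterlim (\<lambda>w. (fst w + snd w *\<^sub>R h, snd w)) (nhds x \<times>\<^sub>F at_right 0) (nhds x \<times>\<^sub>F at_right 0)"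
      using filterlim_clarke_translate[of h x]
      by (intro filterlim_Pair) (auto simp: case_prod_unfold filterlim_def filtermap_snd_prod_filter)
    from eventually_compose_filterlim[OF k this]
    have "\<forall>\<^sub>F (z, t) in nhds x \<times>\<^sub>F at_right 0.
        (f (z + t *\<^sub>R h + t *\<^sub>R k) - f (z + t *\<^sub>R h)) / t < ?p k + e"
      by (simp add: case_prod_unfold)
    with h show "\<forall>\<^sub>F (z, t) in nhds x \<times>\<^sub>F at_right 0. (f (z + t *\<^sub>R (h + k)) - f z) / t < r"
    proof eventually_elim
      case (elim w)
      then show ?case
        using e(2) by (auto simp: case_prod_unfold scaleR_right_distrib add.assoc diff_divide_distrib)
    qed
  qed
next
  fix s :: real and h assume s: "s > 0"
  show "?p (s *\<^sub>R h) \<le> s * ?p h"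
    unfolding clarke_deriv_le_iff
  proof (intro allI impI)
    fix r assume "s * ?p h < r"
    then have "?p h < r / s" using s by (simp add: field_simps)
    then have "\<forall>\<^sub>F (z, t) in nhds x \<times>\<^sub>F at_right 0. (f (z + t *\<^sub>R h) - f z) / t < r / s"
      using clarke_deriv_le_iff[of h "?p h"] by auto
    from eventually_compose_filterlim[OF this filterlim_clarke_scale[OF s]]
    show "\<forall>\<^sub>F (z, t) in nhds x \<times>\<^sub>F at_right 0. (f (z + t *\<^sub>R s *\<^sub>R h) - f z) / t < r"
    proof eventually_elim
      case (elim w)
      obtain z t where w: "w = (z, t)" by (cases w)
      have "((f (z + t *\<^sub>R s *\<^sub>R h) - f z) / t) / s < r / s"
        using elim by (simp add: w mult.commute)
      then show ?case using s unfolding w prod.case divide_less_cancel by blast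
    qed
  qed
qed

text \<open>The Clarke derivative is the support function of the Clarke gradient, with the supremum
  attained.\<close>

lemma clarke_gradient_attains:
  "\<exists>b\<in>clarke_gradient f x. ereal (blinfun_apply b h) = clarke_deriv f x h"
proof -
  have "real_of_ereal (clarke_deriv f x k) \<le> L * norm k" for k
    using clarke_deriv_bounds(1)[of k] by (metis clarke_deriv_real ereal_less_eq(3))
  then obtain b :: "'a dual" where b: "\<And>k. blinfun_apply b k \<le> real_of_ereal (clarke_deriv f x k)"
      "blinfun_apply b h = real_of_ereal (clarke_deriv f x h)"
    using sublinear_attained[OF sublinear_clarke_deriv _ lipschitz_on_nonneg[OF L]] by blast
  have "ereal (blinfun_apply b k) \<le> clarke_deriv f x k" for k
    using b(1)[of k] by (metis clarke_deriv_real ereal_less_eq(3))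
  then show ?thesis
    using b(2) clarke_deriv_real[of h] unfolding clarke_gradient_def by (intro bexI[of _ b]) auto
qed

end

section \<open>From single points to the set \<open>A\<close>\<close>

context
  fixes f :: "'a::real_normed_vector \<Rightarrow> real" and A U :: "'a set" and L :: real
  assumes U: "open U" and L: "L-lipschitz_on U f" and A: "A \<subseteq> U" and ne: "A \<noteq> {}"
begin

lemma deriv_on_bounds:
  "deriv_on f A h \<le> ereal (L * norm h)" "ereal (- (L * norm h)) \<le> deriv_on f A h"
proof -
  show "deriv_on f A h \<le> ereal (L * norm h)"
    unfolding deriv_on_def using A by (intro SUP_least clarke_deriv_bounds(1)[OF U L]) auto
  obtain y where "y \<in> A" using ne by blast
  then show "ereal (- (L * norm h)) \<le> deriv_on f A h"
    unfolding deriv_on_def using A by (intro SUP_upper2[of y] clarke_deriv_bounds(2)[OF U L]) auto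
qed

lemma deriv_on_real: "ereal (real_of_ereal (deriv_on f A h)) = deriv_on f A h"
  using deriv_on_bounds[of h] by (cases "deriv_on f A h") auto

lemma deriv_on_le_iff:
  "real_of_ereal (deriv_on f A h) \<le> c \<longleftrightarrow> (\<forall>y\<in>A. real_of_ereal (clarke_deriv f y h) \<le> c)"
proof -
  have "real_of_ereal (deriv_on f A h) \<le> c \<longleftrightarrow> deriv_on f A h \<le> ereal c"
    by (metis deriv_on_real ereal_less_eq(3))
  also have "\<dots> \<longleftrightarrow> (\<forall>y\<in>A. clarke_deriv f y h \<le> ereal c)"
    by (simp add: deriv_on_def SUP_le_iff)
  also have "\<dots> \<longleftrightarrow> (\<forall>y\<in>A. real_of_ereal (clarke_deriv f y h) \<le> c)"
    using clarke_deriv_real[OF U L] A by (metis ereal_less_eq(3) subsetD)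
  finally show ?thesis .
qed

lemma sublinear_deriv_on: "sublinear (\<lambda>h. real_of_ereal (deriv_on f A h))" (is "sublinear ?s")
proof (rule sublinearI)
  have le: "real_of_ereal (clarke_deriv f y h) \<le> ?s h" if "y \<in> A" for y h
    using deriv_on_le_iff[of h "?s h"] that by simp
  have sub: "sublinear (\<lambda>h. real_of_ereal (clarke_deriv f y h))" if "y \<in> A" for y
    using sublinear_clarke_deriv[OF U L] A that by blast
  show "?s (h + k) \<le> ?s h + ?s k" for h k
    unfolding deriv_on_le_iff using le sublinear_add[OF sub] by (meson add_mono order_trans)
  show "?s (t *\<^sub>R h) \<le> t * ?s h" if "t > 0" for t h
    unfolding deriv_on_le_iff using le sublinear_scale[OF sub] that by simp
qed

text \<open>Each half-space cut out by a direction \<open>h\<close> is convex, weak* closed and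
  contains every pointwise gradient, so it contains \<open>gradient_on f A\<close>. Conversely, a
  functional outside is separated by some \<open>h\<close> with gap \<open>e\<close>; since
  pointwise gradients attain the Clarke derivatives at \<open>h\<close>, the directional derivative
  on \<open>A\<close> is at most \<open>blinfun_apply a h - e\<close>, contradicting
  domination.\<close>

lemma gradient_on_eq_dominated:
  assumes R: "reflexive_space TYPE('a)"
  shows "gradient_on f A = {a. \<forall>h. blinfun_apply a h \<le> real_of_ereal (deriv_on f A h)}"
    (is "_ = ?K")
proof
  define G where "G = (\<Union>y\<in>A. clarke_gradient f y)"
  have "convex hull G \<subseteq> {a. blinfun_apply a h \<le> real_of_ereal (deriv_on f A h)}" for h
  proof (rule hull_minimal)
    show "G \<subseteq> {a. blinfun_apply a h \<le> real_of_ereal (deriv_on f A h)}"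
    proof
      fix a assume "a \<in> G"
      then obtain y where y: "y \<in> A" "ereal (blinfun_apply a h) \<le> clarke_deriv f y h"
        by (auto simp: G_def clarke_gradient_def)
      then have "ereal (blinfun_apply a h) \<le> deriv_on f A h"
        unfolding deriv_on_def by (rule SUP_upper2)
      then show "a \<in> {a. blinfun_apply a h \<le> real_of_ereal (deriv_on f A h)}"
        by (metis deriv_on_real ereal_less_eq(3) mem_Collect_eq)
    qed
    show "convex {a. blinfun_apply a h \<le> real_of_ereal (deriv_on f A h)}"
      by (rule convexI) (auto simp: blinfun.add_left blinfun.scaleR_left intro: convex_bound_le)
  qed
  then have "gradient_on f A \<subseteq> {a. blinfun_apply a h \<le> real_of_ereal (deriv_on f A h)}" for h
    unfolding gradient_on_def G_def
    by (intro closure_of_minimal closedin_weak_star_halfspace)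
  then show "gradient_on f A \<subseteq> ?K" by blast
  have attain: "\<exists>b\<in>convex hull G. ereal (blinfun_apply b h) = clarke_deriv f y h" if "y \<in> A" for y h
    using clarke_gradient_attains[OF U L, of y h] that A
    by (force simp: G_def intro: hull_inc)
  show "?K \<subseteq> gradient_on f A"
  proof (rule subsetI, rule ccontr)
    fix a assume a: "a \<in> ?K" "a \<notin> gradient_on f A"
    have "convex hull G \<noteq> {}" using ne attain by blast
    with a(2) obtain h e where he: "0 < e"
      "\<And>b. b \<in> convex hull G \<Longrightarrow> blinfun_apply b h + e \<le> blinfun_apply a h"
      using weak_star_closure_separation[OF R, of "convex hull G" a]
      by (auto simp: gradient_on_def G_def)
    have "real_of_ereal (deriv_on f A h) \<le> blinfun_apply a h - e"
      unfolding deriv_on_le_iff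
    proof
      fix y assume "y \<in> A"
      then obtain b where "b \<in> convex hull G" "ereal (blinfun_apply b h) = clarke_deriv f y h"
        using attain by blast
      with he(2)[of b] show "real_of_ereal (clarke_deriv f y h) \<le> blinfun_apply a h - e"
        by (metis le_diff_eq real_of_ereal.simps(1))
    qed
    moreover have "blinfun_apply a h \<le> real_of_ereal (deriv_on f A h)"
      using a(1) by blast
    ultimately show False using he(1) by simp
  qed
qed

end

theorem theorem3p10:
  fixes f :: "'a::banach \<Rightarrow> real" and A :: "'a set"
  assumes "reflexive_space TYPE('a)"
    and "strictly_convex_space TYPE('a)"
    and "strictly_convex_space TYPE('a dual)"
    and "A \<noteq> {}"
    and "\<exists>N L. neighborhood_of N A \<and> L-lipschitz_on N f"
  shows "(\<exists>!a. minimal_norm_element (gradient_on f A) a) \<and>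
    (0 \<notin> gradient_on f A \<longrightarrow>
      (\<exists>!h. optimal_descent_direction f A h) \<and>
      (\<forall>a. minimal_norm_element (gradient_on f A) a \<longrightarrow>
        (\<forall>h. optimal_descent_direction f A h \<longleftrightarrow>
             blinfun_apply a h = - norm a \<and> norm h = 1)))"
proof -
  \<comment> \<open>Shrinking to an open set makes \<open>f\<close> Lipschitz near each point of
    \<open>A\<close> with one common constant, which makes the derivative on \<open>A\<close>
    finite.\<close>
  obtain U L where U: "open U" "A \<subseteq> U" and L: "L-lipschitz_on U f"
    using assms(5) unfolding neighborhood_of_def by (meson lipschitz_on_subset)
  define s where "s h = real_of_ereal (deriv_on f A h)" for h
  have s_eq: "deriv_on f A h = ereal (s h)" for h
    unfolding s_def using deriv_on_real[OF U(1) L U(2) assms(4)] by simp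
  have s: "sublinear s"
    using sublinear_deriv_on[OF U(1) L U(2) assms(4)] by (simp add: s_def[abs_def])
  have s_le: "s h \<le> L * norm h" for h
    using deriv_on_bounds(1)[OF U(1) L U(2) assms(4), of h] by (simp add: s_eq)
  have L0: "L \<ge> 0" by (rule lipschitz_on_nonneg[OF L])
  have K: "gradient_on f A = {a. \<forall>h. blinfun_apply a h \<le> s h}"
    using gradient_on_eq_dominated[OF U(1) L U(2) assms(4,1)] by (simp add: s_def)
  have "convex (gradient_on f A)"
    unfolding K by (rule convex_dominated)
  \<comment> \<open>Strict convexity of the dual acts here, on functionals; that of the space itself
    acts below, on directions.\<close>
  then have unique: "\<exists>!a. minimal_norm_element (gradient_on f A) a"
    using ex_minimal_norm_dominated[OF s s_le L0] minimal_norm_element_unique[OF assms(3)]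
    unfolding K by blast
  have opt: "optimal_descent_direction f A h \<longleftrightarrow>
      norm h = 1 \<and> (\<forall>k. norm k \<le> 1 \<longrightarrow> s h \<le> s k) \<and> s h < 0" for h
    by (simp add: optimal_descent_direction_def s_eq)
  have char: "optimal_descent_direction f A h \<longleftrightarrow> blinfun_apply a h = - norm a \<and> norm h = 1"
    and ex: "\<exists>h. norm h = 1 \<and> blinfun_apply a h = - norm a" and nz: "a \<noteq> 0"
    if "0 \<notin> gradient_on f A" "minimal_norm_element (gradient_on f A) a" for a h
  proof -
    show nz: "a \<noteq> 0" using that by (auto simp: minimal_norm_element_def)
    note * = optimal_descent_of_sublinear[OF assms(1,2) s s_le L0 that(2)[unfolded K] nz]
    show "optimal_descent_direction f A h \<longleftrightarrow> blinfun_apply a h = - norm a \<and> norm h = 1"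
      unfolding opt by (rule *(2))
    show "\<exists>h. norm h = 1 \<and> blinfun_apply a h = - norm a" by (rule *(1))
  qed
  have "\<exists>!h. optimal_descent_direction f A h" if "0 \<notin> gradient_on f A"
  proof -
    obtain a where a: "minimal_norm_element (gradient_on f A) a" using unique by blast
    show ?thesis
      unfolding char[OF that a] using ex[OF that a]
        norm_attaining_direction_unique[OF assms(2) nz[OF that a]] by blast
  qed
  with unique char show ?thesis by blast
qed

end
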